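(* Consider the pre-filtered implicit Euler method (IE-Pre-2) for $u_t=F(u)$ with time step $\Delta t$: $$y^{(1)}=-\tfrac12u^{n-2}+u^{n-1}+\tfrac12u^{n},\qquad u^{n+1}=y^{(1)}+\Delta t\,F(u^{n+1}).$$ This method is second order accurate and L-stable.
   Context: Second order accurate means consistent of order $2$: if $u$ is a smooth exact solution of $u_t=F(u)$ with $F$ smooth, and $u^{n-2},u^{n-1},u^n$ are the exact values $u(t_n-2\Delta t),u(t_n-\Delta t),u(t_n)$, then the computed value satisfies $u^{n+1}-u(t_n+\Delta t)=O(\Delta t^{3})$ as $\Delta t\to0$. Applied to the scalar linear equation $u_t=\lambda u$, with $z=\lambda\Delta t\in\mathbb C$, the method reads $(u^{n-1},u^n,u^{n+1})^T=M(z)(u^{n-2},u^{n-1},u^n)^T$ with $$M(z)=\begin{pmatrix}0&1&0\\0&0&1\\ \frac{-1}{2(1-z)}&\frac{1}{1-z}&\frac{1}{2(1-z)}\end{pmatrix}.$$ The method is linearly stable at $z$ if $M(z)$ satisfies the root condition: all eigenvalues of $M(z)$ have modulus at most one, and each eigenvalue of modulus one has algebraic multiplicity one. It is A-stable if it is linearly stable at every $z$ with $\operatorname{Re}z\le0$. It is L-stable if it is A-stable and all eigenvalues of $M(z)$ tend to $0$ as $z\to-\infty$. *)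

theory Defs
  imports "HOL-Analysis.Analysis" "Jordan_Normal_Form.Char_Poly"
begin

(* The derivative of order n along n arbitrary directions; on an open subset of a
   finite-dimensional space this gives the usual C^n functions. *)
fun higher_differentiable_on ::
  "nat \<Rightarrow> 'a::euclidean_space set \<Rightarrow> ('a \<Rightarrow> 'b::euclidean_space) \<Rightarrow> bool" where
  "higher_differentiable_on 0 S f \<longleftrightarrow> continuous_on S f"
| "higher_differentiable_on (Suc n) S f \<longleftrightarrow>
     (\<forall>x\<in>S. f differentiable (at x)) \<and>
     (\<forall>v. higher_differentiable_on n S (\<lambda>x. frechet_derivative f (at x) v))"

definition smooth_on :: "'a::euclidean_space set \<Rightarrow> ('a \<Rightarrow> 'b::euclidean_space) \<Rightarrow> bool" where
  "smooth_on S f \<longleftrightarrow> (\<forall>n. higher_differentiable_on n S f)"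

(* A method is a relation: step F h u2 u1 u0 v means that v is an admissible value of
   u^(n+1) computed from u2 = u^(n-2), u1 = u^(n-1), u0 = u^n with time step h for
   u_t = F(u). A relation is used because the method is implicit. *)
type_synonym 'a three_step_method =
  "('a \<Rightarrow> 'a) \<Rightarrow> real \<Rightarrow> 'a \<Rightarrow> 'a \<Rightarrow> 'a \<Rightarrow> 'a \<Rightarrow> bool"

definition ie_pre2_step :: "'a::real_vector three_step_method" where
  "ie_pre2_step F h u2 u1 u0 v \<longleftrightarrow>
     (let y = - (1/2) *\<^sub>R u2 + u1 + (1/2) *\<^sub>R u0 in v = y + h *\<^sub>R F v)"

definition exact_solution_on ::
  "('a::euclidean_space \<Rightarrow> 'a) \<Rightarrow> 'a set \<Rightarrow> real set \<Rightarrow> (real \<Rightarrow> 'a) \<Rightarrow> bool" where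
  "exact_solution_on F \<Omega> T u \<longleftrightarrow>
     (\<forall>s\<in>T. u s \<in> \<Omega> \<and> (u has_vector_derivative F (u s)) (at s))"

(* An implicit equation may have spurious solutions far from u(t), or near the boundary of
   the domain of F, that escape every compact set as h tends to 0. The computed value is
   therefore sought in a compact neighbourhood K of u(t), which is arbitrary: for small h it
   has to exist in K, be unique there, and have local error O(h^(p+1)). *)
definition consistent_of_order :: "nat \<Rightarrow> 'a::euclidean_space three_step_method \<Rightarrow> bool" where
  "consistent_of_order p step \<longleftrightarrow>
     (\<forall>F \<Omega> a b u t K.
        open \<Omega> \<longrightarrow> smooth_on \<Omega> F \<longrightarrow>
        smooth_on {a<..<b} u \<longrightarrow> exact_solution_on F \<Omega> {a<..<b} u \<longrightarrow> t \<in> {a<..<b} \<longrightarrow>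
        compact K \<longrightarrow> K \<subseteq> \<Omega> \<longrightarrow> u t \<in> interior K \<longrightarrow>
        (\<exists>C. \<forall>\<^sub>F h in at_right 0.
           (\<exists>!v. v \<in> K \<and> step F h (u (t - 2 * h)) (u (t - h)) (u t) v) \<and>
           (\<forall>v\<in>K. step F h (u (t - 2 * h)) (u (t - h)) (u t) v \<longrightarrow>
              norm (v - u (t + h)) \<le> C * h ^ (p + 1))))"

definition ie_pre2_matrix :: "complex \<Rightarrow> complex mat" where
  "ie_pre2_matrix z = mat_of_rows_list 3
     [[0, 1, 0],
      [0, 0, 1],
      [- 1 / (2 * (1 - z)), 1 / (1 - z), 1 / (2 * (1 - z))]]"

(* For u_t = c u the method is the linear recursion given by the matrix above
   at z = c h. *)
lemma ie_pre2_step_linear: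
  fixes c u2 u1 u0 v :: complex and h :: real
  assumes "c * of_real h \<noteq> 1"
  shows "ie_pre2_step (\<lambda>u. c * u) h u2 u1 u0 v \<longleftrightarrow>
    vec_of_list [u1, u0, v] = ie_pre2_matrix (c * of_real h) *\<^sub>v vec_of_list [u2, u1, u0]"
proof -
  define z where "z = c * of_real h"
  define w where "w = 1 - z"
  have nz: "w \<noteq> 0" using assms by (simp add: z_def w_def)
  have M: "ie_pre2_matrix z = mat_of_rows_list 3
      [[0, 1, 0], [0, 0, 1], [- 1 / (2 * w), 1 / w, 1 / (2 * w)]]"
    by (simp add: ie_pre2_matrix_def w_def)
  have row: "ie_pre2_matrix z *\<^sub>v vec_of_list [u2, u1, u0] =
      vec_of_list [u1, u0, (- u2 / 2 + u1 + u0 / 2) / w]"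
  proof (rule eq_vecI)
    show "dim_vec (ie_pre2_matrix z *\<^sub>v vec_of_list [u2, u1, u0]) =
        dim_vec (vec_of_list [u1, u0, (- u2 / 2 + u1 + u0 / 2) / w])"
      by (simp add: M mat_of_rows_list_def)
  next
    fix i assume "i < dim_vec (vec_of_list [u1, u0, (- u2 / 2 + u1 + u0 / 2) / w])"
    then have "i = 0 \<or> i = 1 \<or> i = 2" by auto
    then show "vec_index (ie_pre2_matrix z *\<^sub>v vec_of_list [u2, u1, u0]) i =
        vec_index (vec_of_list [u1, u0, (- u2 / 2 + u1 + u0 / 2) / w]) i"
      using nz
      by (auto simp: M mat_of_rows_list_def scalar_prod_def row_def
          vec_of_list_index numeral_3_eq_3 numeral_2_eq_2 field_simps simp del: vec_of_list_Cons)
  qed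
  have "ie_pre2_step (\<lambda>u. c * u) h u2 u1 u0 v \<longleftrightarrow> w * v = - u2 / 2 + u1 + u0 / 2"
    by (auto simp: ie_pre2_step_def z_def w_def scaleR_conv_of_real algebra_simps)
  also have "\<dots> \<longleftrightarrow> v = (- u2 / 2 + u1 + u0 / 2) / w"
    using nz by (auto simp: field_simps)
  also have "\<dots> \<longleftrightarrow> vec_of_list [u1, u0, v] =
      vec_of_list [u1, u0, (- u2 / 2 + u1 + u0 / 2) / w]"
    by (metis list.inject list_vec)
  finally show ?thesis using row by (simp add: z_def)
qed

definition root_condition :: "complex mat \<Rightarrow> bool" where
  "root_condition A \<longleftrightarrow>
     (\<forall>k. eigenvalue A k \<longrightarrow>
        cmod k \<le> 1 \<and> (cmod k = 1 \<longrightarrow> Polynomial.order k (char_poly A) = 1))"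

definition A_stable :: "(complex \<Rightarrow> complex mat) \<Rightarrow> bool" where
  "A_stable M \<longleftrightarrow> (\<forall>z. Re z \<le> 0 \<longrightarrow> root_condition (M z))"

definition L_stable :: "(complex \<Rightarrow> complex mat) \<Rightarrow> bool" where
  "L_stable M \<longleftrightarrow> A_stable M \<and>
     (\<forall>\<epsilon>>0. \<forall>\<^sub>F x :: real in at_bot. \<forall>k. eigenvalue (M (of_real x)) k \<longrightarrow> cmod k < \<epsilon>)"

end

theory Submission
  imports Defs
begin

text \<open>
  Consistency. The step solves \<open>v = y + h F v\<close>, where the filtered value \<open>y\<close> tends to
  \<open>u t\<close> with \<open>h\<close>. Since \<open>F\<close> is Lipschitz on the compact set \<open>K\<close>, the right-hand side is a
  contraction for small \<open>h\<close> and maps a small ball around \<open>u t\<close> into itself; this gives one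
  solution in that ball, and the Lipschitz estimate on all of \<open>K\<close> excludes any other
  (\<open>implicit_euler_unique_solution\<close>). The same estimate bounds the error of \<open>v\<close> by twice the
  residual of the exact value \<open>u (t + h)\<close> in the equation (\<open>implicit_euler_error\<close>). The filter
  coefficients \<open>-1/2, 1, 1/2\<close> are chosen so that this residual and its first two derivatives
  in \<open>h\<close> vanish at \<open>h = 0\<close>, so that it is of third order (\<open>truncation_error\<close>).

  Stability. With \<open>\<mu> = 1 / k\<close> the characteristic equation can be solved for \<open>z\<close>:
  \<open>k\<close> is an eigenvalue at \<open>z\<close> exactly if \<open>z = (1 - \<mu>\<^sup>2) (1 - \<mu> / 2)\<close>. So A-stability says that
  this cubic maps the open unit disk into the right half plane, apart from multiplicities.
  For fixed \<open>Re \<mu>\<close>, the real part of the cubic is an affine function of \<open>|\<mu>|\<^sup>2\<close>, and it is positive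
  at both extreme values \<open>(Re \<mu>)\<^sup>2\<close> and \<open>1\<close> (\<open>cubic_curve_Re_pos\<close>). Double eigenvalues are the
  inverses of the critical points of the cubic; they are the roots of \<open>k\<^sup>2 + 4 k - 3\<close>, none of
  which has modulus one. Finally \<open>|1 - z| |k|\<^sup>3 \<le> 2\<close> for real \<open>z \<le> 0\<close>, which forces
  \<open>k\<close> to \<open>0\<close> as \<open>z\<close> tends to \<open>-\<infinity>\<close>.
\<close>

section \<open>Calculus for smooth functions\<close>

lemma smooth_on_derivative:
  fixes u :: "real \<Rightarrow> 'a::euclidean_space"
  assumes "smooth_on S u"
  obtains u' where "smooth_on S u'"
    and "\<forall>s\<in>S. (u has_vector_derivative u' s) (at s)"
proof
  have hd: "higher_differentiable_on (Suc n) S u" for n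
    using assms by (simp add: smooth_on_def)
  show "smooth_on S (\<lambda>s. frechet_derivative u (at s) 1)"
    using hd by (simp add: smooth_on_def)
  show "\<forall>s\<in>S. (u has_vector_derivative frechet_derivative u (at s) 1) (at s)"
  proof
    fix s assume "s \<in> S"
    then have "u differentiable (at s)" using hd[of 0] by simp
    then have d: "(u has_derivative frechet_derivative u (at s)) (at s)"
      by (simp add: frechet_derivative_works)
    have "frechet_derivative u (at s) x = x *\<^sub>R frechet_derivative u (at s) 1" for x
      using linear_cmul[OF has_derivative_linear[OF d], of x 1] by simp
    then have "frechet_derivative u (at s) = (\<lambda>x. x *\<^sub>R frechet_derivative u (at s) 1)"
      by (rule ext)
    with d show "(u has_vector_derivative frechet_derivative u (at s) 1) (at s)"
      by (metis has_vector_derivative_def)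
  qed
qed

text \<open>
  The set \<open>K\<close> need not be convex, so a bound on the derivative over \<open>K\<close> does not suffice.
  Instead a \<open>C\<^sup>1\<close> function is locally Lipschitz on the open set, and local Lipschitz continuity
  becomes global on compact subsets.
\<close>

lemma smooth_on_imp_lipschitz_on_compact:
  fixes F :: "'a::euclidean_space \<Rightarrow> 'a"
  assumes "smooth_on S F" "open S" "compact K" "K \<subseteq> S"
  obtains L where "L-lipschitz_on K F"
proof -
  define F' where "F' = (\<lambda>x. Blinfun (frechet_derivative F (at x)))"
  have hd: "higher_differentiable_on (Suc 0) S F"
    using assms(1) by (simp only: smooth_on_def)
  have d: "(F has_derivative frechet_derivative F (at x)) (at x)" if "x \<in> S" for x
    using hd that by (simp add: frechet_derivative_works)
  have F': "blinfun_apply (F' x) = frechet_derivative F (at x)" if "x \<in> S" for x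
    unfolding F'_def using has_derivative_bounded_linear[OF d[OF that]]
    by (rule bounded_linear_Blinfun_apply)
  have "continuous_on S F'"
  proof (rule continuous_on_blinfun_componentwise)
    fix i :: 'a
    have "continuous_on S (\<lambda>x. frechet_derivative F (at x) i)"
      using hd by simp
    then show "continuous_on S (\<lambda>x. blinfun_apply (F' x) i)"
      by (rule continuous_on_eq) (simp add: F')
  qed
  then have "continuous_on ((UNIV :: real set) \<times> S) (\<lambda>p. F' (snd p))"
    by (auto intro!: continuous_on_compose2[of S F'] continuous_intros)
  then have "local_lipschitz (UNIV :: real set) S (\<lambda>_. F)"
    using assms(2) d F'
    by (intro c1_implies_local_lipschitz[where f' = "\<lambda>p. F' (snd p)"]) auto
  then have "local_lipschitz {0 :: real} K (\<lambda>_. F)"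
    by (rule local_lipschitz_subset) (use assms in auto)
  then obtain L where "\<And>t. t \<in> {0 :: real} \<Longrightarrow> L-lipschitz_on K F"
    by (rule local_lipschitz_compact_implies_lipschitz) (use assms in auto)
  then show ?thesis using that by blast
qed

text \<open>
  Integrating a bound of order \<open>n\<close> from \<open>0\<close> gains one order. Iterated, this replaces a Taylor
  expansion with remainder for functions with values in a normed space.
\<close>

lemma norm_le_power_from_derivative:
  fixes g :: "real \<Rightarrow> 'a::real_normed_vector"
  assumes "g 0 = 0" "0 \<le> C"
    and g': "\<And>s. 0 \<le> s \<Longrightarrow> s \<le> d \<Longrightarrow> (g has_vector_derivative g' s) (at s)"
    and bound: "\<And>s. 0 \<le> s \<Longrightarrow> s \<le> d \<Longrightarrow> norm (g' s) \<le> C * s ^ n"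
    and s: "0 \<le> s" "s \<le> d"
  shows "norm (g s) \<le> C * s ^ Suc n"
proof (cases "s = 0")
  case False
  then have "0 < s" using s by simp
  then have "norm (g s - g 0) \<le> C * s ^ Suc n - C * 0 ^ Suc n"
  proof (rule differentiable_bound_general[where f' = g'
        and \<phi>' = "\<lambda>x. C * (real (Suc n) * x ^ n)"])
    show "continuous_on {0..s} g"
      using g' s(2) has_vector_derivative_continuous
      by (intro continuous_at_imp_continuous_on ballI) fastforce
    show "continuous_on {0..s} (\<lambda>x. C * x ^ Suc n)" by (intro continuous_intros)
    fix x assume x: "0 < x" "x < s"
    show "(g has_vector_derivative g' x) (at x)" using x s by (intro g') auto
    have "((\<lambda>x. C * x ^ Suc n) has_real_derivative C * (real (Suc n) * x ^ n)) (at x)"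
      by (auto intro!: derivative_eq_intros simp del: power_Suc)
    then show "((\<lambda>x. C * x ^ Suc n) has_vector_derivative C * (real (Suc n) * x ^ n)) (at x)"
      by (simp only: has_real_derivative_iff_has_vector_derivative)
    have "norm (g' x) \<le> C * x ^ n" using x s by (intro bound) auto
    also have "\<dots> \<le> C * (real (Suc n) * x ^ n)"
      using x \<open>0 \<le> C\<close> by (intro mult_left_mono) (auto simp: algebra_simps)
    finally show "norm (g' x) \<le> C * (real (Suc n) * x ^ n)" .
  qed
  then show ?thesis using assms(1) by simp
qed (use assms(1) in simp)

lemma has_vector_derivative_along_line:
  fixes u :: "real \<Rightarrow> 'a::real_normed_vector"
  assumes "(u has_vector_derivative u' (t + c * h)) (at (t + c * h))"
  shows "((\<lambda>h. u (t + c * h)) has_vector_derivative c *\<^sub>R u' (t + c * h)) (at h)"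
proof -
  have "((\<lambda>h. t + c * h) has_vector_derivative c) (at h)"
    by (auto intro!: derivative_eq_intros
        simp flip: has_real_derivative_iff_has_vector_derivative)
  from vector_diff_chain_at[OF this] assms show ?thesis by (simp add: o_def)
qed

section \<open>Consistency\<close>

text \<open>
  The residual \<open>e\<close> has \<open>e 0 = e' 0 = e'' 0 = 0\<close>, which are the order conditions on the
  coefficients. Its third derivative involves at most four derivatives of \<open>u\<close> at the points
  \<open>t - 2 h, t - h, t + h\<close> and is bounded near \<open>0\<close> by compactness; three integrations then give
  the order \<open>h\<^sup>3\<close>.
\<close>

lemma truncation_error:
  fixes u :: "real \<Rightarrow> 'a::euclidean_space"
  assumes "smooth_on {a<..<b} u" "t \<in> {a<..<b}"
    and "\<And>s. s \<in> {a<..<b} \<Longrightarrow> (u has_vector_derivative u' s) (at s)"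
  obtains C where "\<forall>\<^sub>F h in at_right 0.
    norm (- (1/2) *\<^sub>R u (t - 2 * h) + u (t - h) + (1/2) *\<^sub>R u t + h *\<^sub>R u' (t + h) - u (t + h))
      \<le> C * h ^ 3"
proof -
  obtain u1 where u1: "smooth_on {a<..<b} u1"
    "\<forall>s\<in>{a<..<b}. (u has_vector_derivative u1 s) (at s)"
    using smooth_on_derivative[OF assms(1)] by metis
  obtain u2 where u2: "smooth_on {a<..<b} u2"
    "\<forall>s\<in>{a<..<b}. (u1 has_vector_derivative u2 s) (at s)"
    using smooth_on_derivative[OF u1(1)] by metis
  obtain u3 where u3: "smooth_on {a<..<b} u3"
    "\<forall>s\<in>{a<..<b}. (u2 has_vector_derivative u3 s) (at s)"
    using smooth_on_derivative[OF u2(1)] by metis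
  obtain u4 where u4: "smooth_on {a<..<b} u4"
    "\<forall>s\<in>{a<..<b}. (u3 has_vector_derivative u4 s) (at s)"
    using smooth_on_derivative[OF u3(1)] by metis
  \<comment> \<open>For steps up to \<open>d\<close> all nodes \<open>t - 2 h, t - h, t + h\<close> stay inside the interval.\<close>
  define d where "d = min ((t - a) / 3) ((b - t) / 2)"
  have "0 < d" using assms(2) by (auto simp: d_def)
  have mem: "t + c * s \<in> {a<..<b}" if "0 \<le> s" "s \<le> d" "c \<in> {-2, -1, 1}" for c s
    using that assms(2) by (auto simp: d_def field_simps)
  have shift: "((\<lambda>h. v (t + c * h)) has_vector_derivative c *\<^sub>R v' (t + c * h)) (at h)"
    if "\<forall>s\<in>{a<..<b}. (v has_vector_derivative v' s) (at s)"
      "0 \<le> h" "h \<le> d" "c \<in> {-2, -1, 1}" for v v' c h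
    using that mem by (intro has_vector_derivative_along_line) blast
  note rules = has_vector_derivative_add has_vector_derivative_diff has_vector_derivative_const
    has_vector_derivative_scaleR[OF DERIV_ident]
    bounded_linear.has_vector_derivative[OF bounded_linear_scaleR_right]
  \<comment> \<open>The residual and its derivatives in \<open>h\<close>; the factors \<open>1\<close> and \<open>-1\<close> are written out
      so that every term has the shape \<open>v (t + c * h)\<close> of the rule \<open>shift\<close>.\<close>
  define e where "e = (\<lambda>h. - (1/2) *\<^sub>R u (t + (-2) * h) + u (t + (-1) * h) + (1/2) *\<^sub>R u t
    + h *\<^sub>R u1 (t + 1 * h) - u (t + 1 * h))"
  define e1 where "e1 = (\<lambda>h. u1 (t + (-2) * h) - u1 (t + (-1) * h) + h *\<^sub>R u2 (t + 1 * h))"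
  define e2 where "e2 = (\<lambda>h. (-2) *\<^sub>R u2 (t + (-2) * h) + u2 (t + (-1) * h) + u2 (t + 1 * h)
    + h *\<^sub>R u3 (t + 1 * h))"
  define e3 where "e3 = (\<lambda>h. 4 *\<^sub>R u3 (t + (-2) * h) - u3 (t + (-1) * h)
    + u3 (t + 1 * h) + u3 (t + 1 * h) + h *\<^sub>R u4 (t + 1 * h))"
  have de: "(e has_vector_derivative e1 h) (at h)" if "0 \<le> h" "h \<le> d" for h
    unfolding e_def e1_def
    by (rule has_vector_derivative_eq_rhs,
      (rule rules shift[OF u1(2) that] shift[OF u2(2) that] insertI1 insertI2)+)
      (simp_all add: algebra_simps)
  have de1: "(e1 has_vector_derivative e2 h) (at h)" if "0 \<le> h" "h \<le> d" for h
    unfolding e1_def e2_def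
    by (rule has_vector_derivative_eq_rhs,
      (rule rules shift[OF u2(2) that] shift[OF u3(2) that] insertI1 insertI2)+)
      (simp_all add: algebra_simps)
  have de2: "(e2 has_vector_derivative e3 h) (at h)" if "0 \<le> h" "h \<le> d" for h
    unfolding e2_def e3_def
    by (rule has_vector_derivative_eq_rhs,
      (rule rules shift[OF u3(2) that] shift[OF u4(2) that] insertI1 insertI2)+)
      (simp_all add: algebra_simps)
  have cont: "continuous_on {a<..<b} u3" "continuous_on {a<..<b} u4"
    using u3(1)[unfolded smooth_on_def, rule_format, of 0]
      u4(1)[unfolded smooth_on_def, rule_format, of 0] by simp_all
  have cont_shift: "continuous_on {0..d} (\<lambda>h. v (t + c * h))"
    if v: "continuous_on {a<..<b} v" and c: "c \<in> {-2, -1, 1}" for v :: "real \<Rightarrow> 'a" and c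
  proof (rule continuous_on_compose2[OF v])
    show "continuous_on {0..d} (\<lambda>h. t + c * h)" by (intro continuous_intros)
    show "(\<lambda>h. t + c * h) ` {0..d} \<subseteq> {a<..<b}" using mem c by fastforce
  qed
  have "continuous_on {0..d} e3"
    unfolding e3_def
    by (intro continuous_on_add continuous_on_diff continuous_on_scaleR continuous_on_const
        continuous_on_id cont_shift[OF cont(1)] cont_shift[OF cont(2)]) simp_all
  then have "bounded (e3 ` {0..d})"
    by (intro compact_imp_bounded compact_continuous_image) auto
  then obtain C where C: "0 < C" "\<And>h. 0 \<le> h \<Longrightarrow> h \<le> d \<Longrightarrow> norm (e3 h) \<le> C * h ^ 0"
    unfolding bounded_pos by auto
  have bound2: "norm (e2 h) \<le> C * h ^ Suc 0" if "0 \<le> h" "h \<le> d" for h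
    by (rule norm_le_power_from_derivative[OF _ _ de2 C(2)])
      (use C(1) that in \<open>auto simp: e2_def algebra_simps scaleR_2\<close>)
  have bound1: "norm (e1 h) \<le> C * h ^ Suc (Suc 0)" if "0 \<le> h" "h \<le> d" for h
    by (rule norm_le_power_from_derivative[OF _ _ de1 bound2])
      (use C(1) that in \<open>auto simp: e1_def\<close>)
  have bound: "norm (e h) \<le> C * h ^ Suc (Suc (Suc 0))" if "0 \<le> h" "h \<le> d" for h
    by (rule norm_le_power_from_derivative[OF _ _ de bound1])
      (use C(1) that in \<open>auto simp: e_def algebra_simps\<close>)
  have "\<forall>\<^sub>F h in at_right 0. h \<in> {0<..<d}"
    using \<open>0 < d\<close> by (rule eventually_at_right_real)
  then have "\<forall>\<^sub>F h in at_right 0. norm (- (1/2) *\<^sub>R u (t - 2 * h) + u (t - h) + (1/2) *\<^sub>R u t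
      + h *\<^sub>R u' (t + h) - u (t + h)) \<le> C * h ^ 3"
  proof eventually_elim
    case (elim h)
    then have "t + h \<in> {a<..<b}" using mem[of h 1] by simp
    then have "u' (t + h) = u1 (t + h)"
      using vector_derivative_unique_at[OF assms(3)] u1(2) by blast
    then show ?case using bound[of h] elim by (simp add: e_def numeral_3_eq_3)
  qed
  then show ?thesis by (rule that)
qed

text \<open>
  Subtracting \<open>w = (y + h F w) - residual\<close> from \<open>v = y + h F v\<close> leaves a Lipschitz term of size
  at most half of \<open>norm (v - w)\<close>, which is absorbed on the left.
\<close>

lemma implicit_euler_error:
  fixes F :: "'a::real_normed_vector \<Rightarrow> 'a"
  assumes "L-lipschitz_on K F" "0 \<le> h" "h * L \<le> 1/2"
    and "v \<in> K" "w \<in> K" "v = y + h *\<^sub>R F v"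
  shows "norm (v - w) \<le> 2 * norm (y + h *\<^sub>R F w - w)"
proof -
  have "norm (v - w) = norm (h *\<^sub>R (F v - F w) + (y + h *\<^sub>R F w - w))"
    using assms(6) by (simp add: algebra_simps)
  also have "\<dots> \<le> norm (h *\<^sub>R (F v - F w)) + norm (y + h *\<^sub>R F w - w)"
    by (rule norm_triangle_ineq)
  also have "norm (h *\<^sub>R (F v - F w)) \<le> h * (L * norm (v - w))"
    using lipschitz_onD[OF assms(1,4,5)] \<open>0 \<le> h\<close> by (simp add: dist_norm mult_left_mono)
  also have "\<dots> \<le> 1/2 * norm (v - w)"
    using mult_right_mono[OF assms(3) norm_ge_zero[of "v - w"]] by (simp add: mult.assoc)
  finally show ?thesis by simp
qed

text \<open>
  The fixed point theorem is applied on the ball only, because the right-hand side need not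
  map \<open>K\<close> to itself. Uniqueness on \<open>K\<close> is the error estimate with residual \<open>0\<close>.
\<close>

lemma implicit_euler_unique_solution:
  fixes F :: "'a::banach \<Rightarrow> 'a"
  assumes lip: "L-lipschitz_on K F" and h: "0 \<le> h" "h * L \<le> 1/2"
    and r: "0 \<le> r" "cball x r \<subseteq> K" "norm (y - x) + h * norm (F x) \<le> r / 2"
  shows "\<exists>!v. v \<in> K \<and> v = y + h *\<^sub>R F v"
proof -
  let ?G = "\<lambda>v. y + h *\<^sub>R F v"
  have x: "x \<in> K" using r(1,2) by auto
  have contract: "dist (?G v) (?G w) \<le> 1/2 * dist v w" if "v \<in> K" "w \<in> K" for v w
  proof -
    have "dist (?G v) (?G w) = h * dist (F v) (F w)"
      using h(1) by (simp add: dist_norm flip: scaleR_diff_right)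
    also have "\<dots> \<le> h * (L * dist v w)"
      using lipschitz_onD[OF lip that] h(1) by (rule mult_left_mono)
    also have "\<dots> \<le> 1/2 * dist v w"
      using mult_right_mono[OF h(2) zero_le_dist[of v w]] by (simp add: mult.assoc)
    finally show ?thesis .
  qed
  have "\<exists>!v\<in>cball x r. ?G v = v"
  proof (rule Banach_fix[where c = "1/2"])
    show "?G ` cball x r \<subseteq> cball x r"
    proof (rule image_subsetI)
      fix v assume v: "v \<in> cball x r"
      have "dist x (?G v) \<le> dist x (?G x) + dist (?G x) (?G v)" by (rule dist_triangle)
      also have "dist x (?G x) \<le> norm (y - x) + h * norm (F x)"
        using norm_triangle_ineq[of "y - x" "h *\<^sub>R F x"] h(1)
        by (simp add: dist_norm norm_minus_commute algebra_simps)
      also have "dist (?G x) (?G v) \<le> 1/2 * r"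
        using contract[of x v] x v r(2) by (auto simp: subset_iff)
      finally show "?G v \<in> cball x r" using r(3) by simp
    qed
    show "dist (?G v) (?G w) \<le> 1/2 * dist v w" if "v \<in> cball x r" "w \<in> cball x r" for v w
      using contract that r(2) by blast
  qed (use r(1) in \<open>auto simp: complete_eq_closed\<close>)
  then obtain v where v: "v \<in> K" "v = ?G v" using r(2) by (metis subsetD)
  moreover have "w = v" if "w \<in> K" "w = ?G w" for w
    using implicit_euler_error[OF lip h that(1) v(1) that(2)] v(2) by simp
  ultimately show ?thesis by blast
qed

lemma ie_pre2_consistent:
  "consistent_of_order 2 (ie_pre2_step :: 'a::euclidean_space three_step_method)"
  unfolding consistent_of_order_def
proof (intro allI impI)
  fix F :: "'a \<Rightarrow> 'a" and \<Omega> a b u t K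
  assume "open \<Omega>" "smooth_on \<Omega> F" and u: "smooth_on {a<..<b} u"
    and sol: "exact_solution_on F \<Omega> {a<..<b} u" and t: "t \<in> {a<..<b}"
    and "compact K" "K \<subseteq> \<Omega>" and utK: "u t \<in> interior K"
  then obtain L where lip: "L-lipschitz_on K F"
    using smooth_on_imp_lipschitz_on_compact by blast
  have u': "(u has_vector_derivative F (u s)) (at s)" if "s \<in> {a<..<b}" for s
    using sol that by (auto simp: exact_solution_on_def)
  obtain C where trunc: "\<forall>\<^sub>F h in at_right 0.
      norm (- (1/2) *\<^sub>R u (t - 2 * h) + u (t - h) + (1/2) *\<^sub>R u t + h *\<^sub>R F (u (t + h)) - u (t + h))
        \<le> C * h ^ 3"
    using truncation_error[OF u t u'] by blast
  obtain r where r: "0 < r" "cball (u t) r \<subseteq> K"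
    using utK by (auto simp: mem_interior_cball)
  have "isCont u t" using u'[OF t] by (rule has_vector_derivative_continuous)
  then have lim: "((\<lambda>h. u (t + c * h)) \<longlongrightarrow> u t) (at_right 0)" for c
    by (rule isCont_tendsto_compose) (auto intro!: tendsto_eq_intros)
  define y where "y = (\<lambda>h. - (1/2) *\<^sub>R u (t - 2 * h) + u (t - h) + (1/2) *\<^sub>R u t)"
  have "(y \<longlongrightarrow> - (1/2) *\<^sub>R u t + u t + (1/2) *\<^sub>R u t) (at_right 0)"
    unfolding y_def using lim[of "-2"] lim[of "-1"] by (intro tendsto_intros) simp_all
  then have "(y \<longlongrightarrow> u t) (at_right 0)" by simp
  then have "((\<lambda>h. norm (y h - u t) + h * norm (F (u t))) \<longlongrightarrow>
      norm (u t - u t) + 0 * norm (F (u t))) (at_right 0)"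
    by (intro tendsto_intros)
  then have near: "\<forall>\<^sub>F h in at_right 0. norm (y h - u t) + h * norm (F (u t)) < r / 2"
    by (rule order_tendstoD) (use r in simp)
  have "((\<lambda>h. h * L) \<longlongrightarrow> 0 * L) (at_right 0)" by (intro tendsto_intros)
  then have small: "\<forall>\<^sub>F h in at_right 0. h * L < 1/2"
    by (rule order_tendstoD) simp
  have "\<forall>\<^sub>F h in at_right 0. u (t + h) \<in> interior K"
    using topological_tendstoD[OF lim[of 1] open_interior utK] by simp
  moreover have "\<forall>\<^sub>F h :: real in at_right 0. 0 < h"
    by (rule eventually_at_right_less)
  ultimately have "\<forall>\<^sub>F h in at_right 0.
      (\<exists>!v. v \<in> K \<and> ie_pre2_step F h (u (t - 2 * h)) (u (t - h)) (u t) v) \<and>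
      (\<forall>v\<in>K. ie_pre2_step F h (u (t - 2 * h)) (u (t - h)) (u t) v \<longrightarrow>
         norm (v - u (t + h)) \<le> 2 * C * h ^ (2 + 1))"
    using trunc near small
  proof eventually_elim
    case (elim h)
    have step: "ie_pre2_step F h (u (t - 2 * h)) (u (t - h)) (u t) v \<longleftrightarrow> v = y h + h *\<^sub>R F v" for v
      by (simp add: ie_pre2_step_def y_def)
    have "\<exists>!v. v \<in> K \<and> v = y h + h *\<^sub>R F v"
      by (rule implicit_euler_unique_solution[OF lip, where r = r and x = "u t"]) (use elim r in auto)
    moreover have "norm (v - u (t + h)) \<le> 2 * C * h ^ (2 + 1)"
      if "v \<in> K" "v = y h + h *\<^sub>R F v" for v
    proof -
      have "u (t + h) \<in> K" using elim(1) interior_subset by blast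
      then have "norm (v - u (t + h)) \<le> 2 * norm (y h + h *\<^sub>R F (u (t + h)) - u (t + h))"
        using implicit_euler_error[OF lip _ _ that(1) _ that(2)] elim by simp
      also have "\<dots> \<le> 2 * (C * h ^ 3)"
        using elim(3) by (simp add: y_def)
      finally show ?thesis by simp
    qed
    ultimately show ?case by (simp add: step)
  qed
  then show "\<exists>C. \<forall>\<^sub>F h in at_right 0.
      (\<exists>!v. v \<in> K \<and> ie_pre2_step F h (u (t - 2 * h)) (u (t - h)) (u t) v) \<and>
      (\<forall>v\<in>K. ie_pre2_step F h (u (t - 2 * h)) (u (t - h)) (u t) v \<longrightarrow>
         norm (v - u (t + h)) \<le> C * h ^ (2 + 1))" by blast
qed

section \<open>Stability\<close>

lemma det_2x2:
  fixes A :: "'a::comm_ring_1 mat"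
  assumes "A \<in> carrier_mat 2 2"
  shows "Determinant.det A = A $$ (0, 0) * A $$ (1, 1) - A $$ (0, 1) * A $$ (1, 0)"
  using assms
  by (subst laplace_expansion_column[OF assms, of 0])
    (auto simp: cofactor_def mat_delete_def det_single numeral_2_eq_2 lessThan_Suc)

lemma char_poly_companion3:
  fixes a b c :: "'a::field"
  shows "char_poly (mat_of_rows_list 3 [[0, 1, 0], [0, 0, 1], [a, b, c]]) = [:- a, - b, - c, 1:]"
proof -
  let ?A = "mat_of_rows_list 3 [[0, 1, 0], [0, 0, 1], [a, b, c]]"
  have cm: "char_poly_matrix ?A \<in> carrier_mat 3 3"
    by (simp add: char_poly_matrix_def mat_of_rows_list_def numeral_3_eq_3)
  show ?thesis
    unfolding char_poly_def
    by (subst laplace_expansion_column[OF cm, of 0])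
      (simp_all add: cofactor_def det_2x2 numeral_3_eq_3 numeral_2_eq_2 lessThan_Suc
        mat_delete_def mat_of_rows_list_def char_poly_matrix_def)
qed

text \<open>
  Put \<open>x = Re \<mu>\<close> and \<open>s = |\<mu>|\<^sup>2\<close>, so \<open>x\<^sup>2 \<le> s < 1\<close>. The real part is affine in \<open>s\<close>; its value
  at \<open>s = 1\<close> is \<open>2 (1 - x)\<^sup>2 (1 + x)\<close>, and at \<open>s = x\<^sup>2\<close>, where \<open>\<mu>\<close> is real, it is
  \<open>(1 - x\<^sup>2) (1 - x / 2)\<close>. Both are positive, hence so is every value between them.
\<close>

lemma cubic_curve_Re_pos:
  fixes \<mu> :: complex
  assumes "cmod \<mu> < 1"
  shows "0 < Re ((1 - \<mu>\<^sup>2) * (1 - \<mu> / 2))"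
proof -
  define x where "x = Re \<mu>"
  define s where "s = (cmod \<mu>)\<^sup>2"
  have s: "s = x\<^sup>2 + (Im \<mu>)\<^sup>2" by (simp add: s_def x_def cmod_power2)
  have "s < 1" using assms by (simp add: s_def power_less_one_iff)
  have "x\<^sup>2 \<le> s" by (simp add: s)
  have "\<bar>x\<bar> < 1" using abs_Re_le_cmod[of \<mu>] assms by (simp add: x_def)
  then have x: "-1 < x" "x < 1" by auto
  have Re_eq: "Re ((1 - \<mu>\<^sup>2) * (1 - \<mu> / 2)) = 1 - x / 2 - 2 * x\<^sup>2 + s + 2 * x ^ 3 - 3 * x * s / 2"
    unfolding s x_def by (simp add: power2_eq_square power3_eq_cube field_simps)
  \<comment> \<open>Affine interpolation between \<open>s = 1\<close> and \<open>s = x\<^sup>2\<close>, cleared of the denominator.\<close>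
  have "(1 - x\<^sup>2) * Re ((1 - \<mu>\<^sup>2) * (1 - \<mu> / 2)) =
      (s - x\<^sup>2) * (2 * (1 - x)\<^sup>2 * (1 + x)) + (1 - s) * ((1 - x\<^sup>2) * (1 - x / 2))"
    unfolding Re_eq by (simp add: power2_eq_square power3_eq_cube field_simps)
  also have "0 < \<dots>"
    using x \<open>s < 1\<close> \<open>x\<^sup>2 \<le> s\<close> 
    by (intro add_nonneg_pos mult_nonneg_nonneg mult_pos_pos) auto
  finally show ?thesis
    using \<open>s < 1\<close> \<open>x\<^sup>2 \<le> s\<close> by (simp add: zero_less_mult_iff)
qed

lemma ie_pre2_matrix_carrier: "ie_pre2_matrix z \<in> carrier_mat 3 3"
  by (simp add: ie_pre2_matrix_def mat_of_rows_list_def numeral_3_eq_3)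

lemma char_poly_ie_pre2:
  "char_poly (ie_pre2_matrix z) =
    [:1 / (2 * (1 - z)), - (1 / (1 - z)), - (1 / (2 * (1 - z))), 1:]"
  unfolding ie_pre2_matrix_def char_poly_companion3 by simp

lemma eigenvalue_ie_pre2_iff:
  assumes "z \<noteq> 1"
  shows "eigenvalue (ie_pre2_matrix z) k \<longleftrightarrow> 2 * (1 - z) * k ^ 3 = k\<^sup>2 + 2 * k - 1"
proof -
  have "eigenvalue (ie_pre2_matrix z) k \<longleftrightarrow> poly (char_poly (ie_pre2_matrix z)) k = 0"
    by (rule eigenvalue_root_char_poly[OF ie_pre2_matrix_carrier])
  also have "\<dots> \<longleftrightarrow> 2 * (1 - z) * poly (char_poly (ie_pre2_matrix z)) k = 0"
    using assms by simp
  also have "2 * (1 - z) * poly (char_poly (ie_pre2_matrix z)) k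
      = 2 * (1 - z) * k ^ 3 - (k\<^sup>2 + 2 * k - 1)"
  proof -
    define w where "w = 1 - z"
    have "w \<noteq> 0" using assms by (simp add: w_def)
    then show ?thesis
      unfolding char_poly_ie_pre2 w_def[symmetric]
      by (simp add: field_simps power2_eq_square power3_eq_cube)
  qed
  finally show ?thesis by simp
qed

lemma eigenvalue_ie_pre2_parametrization:
  assumes "z \<noteq> 1" "eigenvalue (ie_pre2_matrix z) k"
  shows "k \<noteq> 0" and "z = (1 - (inverse k)\<^sup>2) * (1 - inverse k / 2)"
proof -
  have eq: "2 * (1 - z) * k ^ 3 = k\<^sup>2 + 2 * k - 1"
    using assms eigenvalue_ie_pre2_iff by blast
  then show "k \<noteq> 0" by auto
  then have "1 - z = (k\<^sup>2 + 2 * k - 1) / (2 * k ^ 3)"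
    using eq by (simp add: field_simps)
  then have "z = 1 - (k\<^sup>2 + 2 * k - 1) / (2 * k ^ 3)"
    by (simp add: algebra_simps)
  then show "z = (1 - (inverse k)\<^sup>2) * (1 - inverse k / 2)"
    using \<open>k \<noteq> 0\<close> by (simp add: field_simps power2_eq_square power3_eq_cube)
qed

lemma eigenvalue_ie_pre2_le_1:
  assumes "Re z \<le> 0" "eigenvalue (ie_pre2_matrix z) k"
  shows "cmod k \<le> 1"
proof (rule ccontr)
  assume "\<not> cmod k \<le> 1"
  then have "cmod (inverse k) < 1" by (simp add: norm_inverse inverse_less_1_iff)
  moreover have "z \<noteq> 1" using assms(1) by auto
  ultimately have "0 < Re z"
    using cubic_curve_Re_pos eigenvalue_ie_pre2_parametrization(2) assms(2) by metis
  then show False using assms(1) by simp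
qed

text \<open>
  Eliminating \<open>z\<close> from the characteristic equation and its derivative shows that a multiple
  eigenvalue satisfies \<open>k\<^sup>2 + 4 k = 3\<close>. On the unit circle, division by \<open>k\<close> gives
  \<open>k + 4 = 3 cnj k\<close>, whose real part says \<open>Re k = 2\<close>.
\<close>

lemma ie_pre2_unimodular_eigenvalue_simple:
  assumes "z \<noteq> 1" "eigenvalue (ie_pre2_matrix z) k" "cmod k = 1"
  shows "Polynomial.order k (char_poly (ie_pre2_matrix z)) = 1"
proof -
  let ?p = "char_poly (ie_pre2_matrix z)"
  define w where "w = 1 - z"
  have "w \<noteq> 0" using assms by (simp add: w_def)
  have root: "poly ?p k = 0" using assms(2) eigenvalue_root_char_poly[OF ie_pre2_matrix_carrier] by blast
  have eq: "2 * w * k ^ 3 = k\<^sup>2 + 2 * k - 1"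
    using assms eigenvalue_ie_pre2_iff by (simp add: w_def)
  have "poly (pderiv ?p) k \<noteq> 0"
  proof
    assume "poly (pderiv ?p) k = 0"
    moreover have "w * poly (pderiv ?p) k = 3 * w * k\<^sup>2 - k - 1"
      unfolding char_poly_ie_pre2 w_def[symmetric] using \<open>w \<noteq> 0\<close>
      by (simp add: pderiv_pCons field_simps power2_eq_square)
    ultimately have "3 * w * k\<^sup>2 = k + 1" by (simp add: algebra_simps)
    then have "2 * k * (3 * w * k\<^sup>2) = 2 * k * (k + 1)" by simp
    moreover have "2 * k * (3 * w * k\<^sup>2) = 3 * (2 * w * k ^ 3)"
      by (simp add: power2_eq_square power3_eq_cube)
    ultimately have "3 * (k\<^sup>2 + 2 * k - 1) = 2 * k * (k + 1)"
      using eq by simp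
    then have k: "k * k + 4 * k = 3" by (simp add: power2_eq_square algebra_simps)
    have "k * cnj k = 1" using assms(3) by (simp add: complex_norm_square[symmetric])
    then have "k + 4 = (k * cnj k) * (k + 4)" by simp
    also have "\<dots> = (k * k + 4 * k) * cnj k" by (simp add: algebra_simps)
    finally have "k + 4 = 3 * cnj k" by (simp add: k)
    then have "Re k + 4 = 3 * Re k" by (simp add: complex_eq_iff)
    then show False using abs_Re_le_cmod[of k] assms(3) by simp
  qed
  then show ?thesis
    using root order_pderiv[of ?p k] order_0I[of "pderiv ?p" k] by fastforce
qed

lemma ie_pre2_A_stable: "A_stable ie_pre2_matrix"
  unfolding A_stable_def root_condition_def
proof (intro allI impI conjI)
  fix z k assume "Re z \<le> 0" "eigenvalue (ie_pre2_matrix z) k"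
  then show "cmod k \<le> 1" by (rule eigenvalue_ie_pre2_le_1)
next
  fix z k assume "Re z \<le> 0" "eigenvalue (ie_pre2_matrix z) k" "cmod k = 1"
  moreover from this have "z \<noteq> 1" by auto
  ultimately show "Polynomial.order k (char_poly (ie_pre2_matrix z)) = 1"
    by (intro ie_pre2_unimodular_eigenvalue_simple)
qed

text \<open>
  The eigenvalue equation reads \<open>2 (1 - x) k\<^sup>3 = k\<^sup>2 + 2 k - 1\<close>, and A-stability bounds its
  right-hand side by \<open>4\<close> uniformly in \<open>x\<close>.
\<close>

lemma eigenvalue_ie_pre2_cube_bound:
  fixes x :: real
  assumes "x \<le> 0" "eigenvalue (ie_pre2_matrix (of_real x)) k"
  shows "(1 - x) * cmod k ^ 3 \<le> 2"
proof -
  have "cmod k \<le> 1" using eigenvalue_ie_pre2_le_1[OF _ assms(2)] assms(1) by simp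
  have "complex_of_real x \<noteq> 1" using assms(1) by (metis Re_complex_of_real one_complex.sel(1) not_one_le_zero)
  then have "2 * (1 - of_real x) * k ^ 3 = k\<^sup>2 + 2 * k - 1"
    using assms(2) eigenvalue_ie_pre2_iff by blast
  then have "cmod (of_real (2 * (1 - x)) * k ^ 3) = cmod (k\<^sup>2 + 2 * k - 1)"
    by simp
  also have "\<dots> \<le> cmod k ^ 2 + 2 * cmod k + 1"
    using norm_triangle_ineq4[of "k\<^sup>2 + 2 * k" 1] norm_triangle_ineq[of "k\<^sup>2" "2 * k"]
    by (simp add: norm_mult norm_power)
  also have "\<dots> \<le> 4"
    using \<open>cmod k \<le> 1\<close> power_le_one[of "cmod k" 2] by simp
  finally show ?thesis
    using assms(1) by (simp add: norm_mult norm_power algebra_simps del: of_real_mult of_real_diff)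
qed

lemma ie_pre2_L_stable: "L_stable ie_pre2_matrix"
  unfolding L_stable_def
proof (intro conjI allI impI ie_pre2_A_stable)
  fix \<epsilon> :: real assume "0 < \<epsilon>"
  have "\<forall>\<^sub>F x :: real in at_bot. x < min 0 (1 - 2 / \<epsilon> ^ 3)"
    by (rule eventually_gt_at_bot)
  then show "\<forall>\<^sub>F x :: real in at_bot. \<forall>k. eigenvalue (ie_pre2_matrix (of_real x)) k \<longrightarrow> cmod k < \<epsilon>"
  proof eventually_elim
    case (elim x)
    show ?case
    proof (intro allI impI, rule ccontr)
      fix k assume k: "eigenvalue (ie_pre2_matrix (of_real x)) k" and "\<not> cmod k < \<epsilon>"
      then have "\<epsilon> ^ 3 \<le> cmod k ^ 3" using \<open>0 < \<epsilon>\<close> by (intro power_mono) auto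
      then have "(1 - x) * \<epsilon> ^ 3 \<le> (1 - x) * cmod k ^ 3"
        using elim by (intro mult_left_mono) auto
      also have "\<dots> \<le> 2" using eigenvalue_ie_pre2_cube_bound[OF _ k] elim by simp
      finally have "1 - x \<le> 2 / \<epsilon> ^ 3" using \<open>0 < \<epsilon>\<close> by (simp add: field_simps)
      then show False using elim by simp
    qed
  qed
qed

theorem mainTheorem3:
  shows "consistent_of_order 2 (ie_pre2_step :: 'a::euclidean_space three_step_method) \<and>
    L_stable ie_pre2_matrix"
  using ie_pre2_consistent ie_pre2_L_stable by blast

end
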